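(* Let $h: J\to[0,\infty)$ and $f:I\to(0,\infty)$. (i) If $h$ is superadditive and $f$ is $\mathrm{H_tH_h}$-concave, then for all $x,y,z\in I$ $$\frac{1}{f\left(\frac{2xz}{x+z}\right)}+\frac{1}{f\left(\frac{2yz}{y+z}\right)}+\frac{1}{f\left(\frac{2xy}{x+y}\right)}\le h(1/2)\left[\frac{1}{f(x)}+\frac{1}{f(y)}+\frac{1}{f(z)}\right]+\frac{h(3/2)}{f\left(\frac{3xyz}{xy+yz+xz}\right)}.$$ (ii) If $h$ is subadditive and $f$ is $\mathrm{H_tH_h}$-convex, then the reverse inequality ($\ge$) holds for all $x,y,z\in I$.
   Context: $I\subseteq(0,\infty)$ is an interval. $J$ is a real interval containing $(0,1)$ and the point $3/2$. The function $h:J\to[0,\infty)$ is such that $h(t)$ and $h(1-t)$ are never both zero. $h$ is superadditive (resp. subadditive) if $h(s+t)\ge h(s)+h(t)$ (resp. $\le$) whenever $s,t,s+t\in J$. A function $f:I\to(0,\infty)$ is $\mathrm{H_tH_h}$-convex if $$f\left(\frac{\alpha\beta}{t\alpha+(1-t)\beta}\right)\le \frac{f(\alpha)f(\beta)}{h(t)f(\alpha)+h(1-t)f(\beta)}$$ for all $\alpha,\beta\in I$ and all $t\in[0,1]$ with $t,1-t\in J$; it is $\mathrm{H_tH_h}$-concave if the reverse inequality ($\ge$) holds for all such $\alpha,\beta,t$. *)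

theory Defs
  imports "HOL-Analysis.Analysis"
begin

(* Functions on a subset of the reals are total functions real => real together with an
   explicit domain (I or J); all conditions are relativised to that domain. *)

definition superadditive_on :: "real set \<Rightarrow> (real \<Rightarrow> real) \<Rightarrow> bool" where
  "superadditive_on J h \<longleftrightarrow>
     (\<forall>s t. s \<in> J \<longrightarrow> t \<in> J \<longrightarrow> s + t \<in> J \<longrightarrow> h (s + t) \<ge> h s + h t)"

definition subadditive_on :: "real set \<Rightarrow> (real \<Rightarrow> real) \<Rightarrow> bool" where
  "subadditive_on J h \<longleftrightarrow>
     (\<forall>s t. s \<in> J \<longrightarrow> t \<in> J \<longrightarrow> s + t \<in> J \<longrightarrow> h (s + t) \<le> h s + h t)"

(* The bound t in [0,1] is separate from membership in J: J always reaches beyond 1,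
   but it need not contain 0, in which case t = 0 and t = 1 are both excluded. *)

definition HtHh_convex :: "real set \<Rightarrow> real set \<Rightarrow> (real \<Rightarrow> real) \<Rightarrow> (real \<Rightarrow> real) \<Rightarrow> bool" where
  "HtHh_convex I J h f \<longleftrightarrow>
     (\<forall>\<alpha>\<in>I. \<forall>\<beta>\<in>I. \<forall>t\<in>{0..1}. t \<in> J \<longrightarrow> 1 - t \<in> J \<longrightarrow>
        f (\<alpha> * \<beta> / (t * \<alpha> + (1 - t) * \<beta>))
          \<le> f \<alpha> * f \<beta> / (h t * f \<alpha> + h (1 - t) * f \<beta>))"

definition HtHh_concave :: "real set \<Rightarrow> real set \<Rightarrow> (real \<Rightarrow> real) \<Rightarrow> (real \<Rightarrow> real) \<Rightarrow> bool" where
  "HtHh_concave I J h f \<longleftrightarrow>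
     (\<forall>\<alpha>\<in>I. \<forall>\<beta>\<in>I. \<forall>t\<in>{0..1}. t \<in> J \<longrightarrow> 1 - t \<in> J \<longrightarrow>
        f (\<alpha> * \<beta> / (t * \<alpha> + (1 - t) * \<beta>))
          \<ge> f \<alpha> * f \<beta> / (h t * f \<alpha> + h (1 - t) * f \<beta>))"

end

theory Submission
  imports Defs
begin

text \<open>
  The substitution \<open>u = 1 / x\<close>, \<open>g u = 1 / f (1 / u)\<close> turns harmonic means into arithmetic ones,
  and the theorem into Popoviciu's inequality for a positive \<open>h\<close>-convex function \<open>g\<close>, that is
  one with \<open>g (t * u + (1 - t) * v) \<le> h t * g u + h (1 - t) * g v\<close>
  and \<open>h\<close> superadditive. The order is reversed by taking reciprocals of values, so that a
  harmonically concave \<open>f\<close> gives an \<open>h\<close>-convex \<open>g\<close>, and a harmonically convex \<open>f\<close> an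
  \<open>h\<close>-concave \<open>g\<close> (lemma \<open>reciprocal_signed_h_convex\<close>).

  For Popoviciu's inequality, let \<open>m\<close> be the mean of the points \<open>a\<close>, \<open>b\<close>, \<open>c\<close>. If no point equals \<open>m\<close>,
  two of them, say \<open>a\<close> and \<open>b\<close>, lie strictly on the same side of \<open>m\<close>. The midpoints of \<open>a, c\<close> and
  of \<open>b, c\<close> then lie strictly between \<open>m\<close> and \<open>c\<close>, and their weights at \<open>m\<close> add up to \<open>3/2\<close>,
  those at \<open>c\<close> to \<open>1/2\<close>. Superadditivity of \<open>h\<close> collects them into \<open>h (3/2) * g m\<close> and
  \<open>h (1/2) * g c\<close>; the midpoint of \<open>a, b\<close> is estimated directly
  (lemma \<open>popoviciu_same_side\<close>).

  If one of the points equals \<open>m\<close>, this argument would need the weights \<open>0\<close> and \<open>1\<close>, and \<open>h 0\<close> may be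
  meaningless. Instead, \<open>h\<close>-convexity at two equal points gives \<open>2 * h (1/2) \<ge> 1\<close>, so
  \<open>h (3/2) \<ge> 2 * h (1/2) + h (1/2) \<ge> 1 + h (1/2)\<close>, which suffices
  (lemma \<open>popoviciu_at_mean\<close>).

  The two parts of the theorem differ by the direction of all the inequalities, but not by the
  sign of \<open>g\<close>. A factor \<open>\<sigma>\<close> in front of both sides of every inequality therefore treats them
  together: \<open>\<sigma> = 1\<close> gives the first part and \<open>\<sigma> = -1\<close> the second.
\<close>

section \<open>Popoviciu's inequality for h-convex functions\<close>

locale signed_h_convex =
  fixes K :: "real set" and h g :: "real \<Rightarrow> real" and \<sigma> :: real
  assumes convex_K: "convex K"
    and pos: "u \<in> K \<Longrightarrow> g u > 0"
    and h_convex: "\<lbrakk>u \<in> K; v \<in> K; 0 < t; t < 1\<rbrakk>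
      \<Longrightarrow> \<sigma> * g (t * u + (1 - t) * v) \<le> \<sigma> * (h t * g u + h (1 - t) * g v)"
    and h_additive: "\<lbrakk>0 < s; 0 < t; s + t \<le> 3/2\<rbrakk> \<Longrightarrow> \<sigma> * (h s + h t) \<le> \<sigma> * h (s + t)"
begin

lemma midpoint:
  assumes "u \<in> K" "v \<in> K"
  shows "\<sigma> * g ((u + v) / 2) \<le> \<sigma> * (h (1/2) * (g u + g v))"
  using h_convex[OF assms, of "1/2"] by (simp add: field_simps)

text \<open>The inequality at two equal points bounds \<open>h (1/2)\<close>, because \<open>g\<close> is positive there.\<close>

lemma h_three_halves:
  assumes "u \<in> K"
  shows "\<sigma> * (1 + h (1/2)) \<le> \<sigma> * h (3/2)"
proof -
  have "g u * \<sigma> \<le> g u * (\<sigma> * (2 * h (1/2)))"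
    using midpoint[OF assms assms] by (simp add: algebra_simps)
  then have "\<sigma> \<le> \<sigma> * (2 * h (1/2))"
    using pos[OF assms] by simp
  moreover have "\<sigma> * (2 * h (1/2)) \<le> \<sigma> * h 1"
    using h_additive[of "1/2" "1/2"] by simp
  moreover have "\<sigma> * (h 1 + h (1/2)) \<le> \<sigma> * h (3/2)"
    using h_additive[of 1 "1/2"] by simp
  ultimately show ?thesis
    by (simp add: algebra_simps)
qed

text \<open>The midpoint of \<open>a\<close> and \<open>b\<close> is the third point itself, so only the other two midpoints
  need an estimate.\<close>

lemma popoviciu_at_mean:
  assumes "a \<in> K" "b \<in> K" "c \<in> K" and mean: "c = (a + b + c) / 3"
  shows "\<sigma> * (g ((a + b) / 2) + g ((a + c) / 2) + g ((b + c) / 2))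
    \<le> \<sigma> * (h (1/2) * (g a + g b + g c) + h (3/2) * g ((a + b + c) / 3))"
proof -
  have mid: "(a + b) / 2 = c"
    using mean by simp
  have "(\<sigma> * (1 + h (1/2))) * g c \<le> (\<sigma> * h (3/2)) * g c"
    using h_three_halves[OF \<open>c \<in> K\<close>] pos[OF \<open>c \<in> K\<close>] by (simp add: mult_right_mono)
  with midpoint[OF \<open>a \<in> K\<close> \<open>c \<in> K\<close>] midpoint[OF \<open>b \<in> K\<close> \<open>c \<in> K\<close>]
  show ?thesis
    unfolding mid mean[symmetric] by (simp add: algebra_simps)
qed

lemma popoviciu_same_side:
  assumes "a \<in> K" "b \<in> K" "c \<in> K"
    and m: "m = (a + b + c) / 3" and same: "(a - m) * (b - m) > 0"
  shows "\<sigma> * (g ((a + b) / 2) + g ((a + c) / 2) + g ((b + c) / 2))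
    \<le> \<sigma> * (h (1/2) * (g a + g b + g c) + h (3/2) * g m)"
proof -
  \<comment> \<open>With \<open>p = a - m\<close> and \<open>q = b - m\<close> one has \<open>c - m = - (p + q)\<close>, and the midpoints
    involving \<open>c\<close> are \<open>m - q / 2\<close> and \<open>m - p / 2\<close>.\<close>
  define p where "p = a - m"
  define q where "q = b - m"
  define s where "s = q / (2 * (p + q))"
  define t where "t = p / (2 * (p + q))"
  have c: "c = m - (p + q)"
    using m by (simp add: p_def q_def field_simps)
  have pq: "p > 0 \<and> q > 0 \<or> p < 0 \<and> q < 0"
    using same by (simp add: p_def q_def zero_less_mult_iff)
  then have sum: "p + q \<noteq> 0"
    by auto
  have st: "s + t = 1/2"
    using sum by (simp add: s_def t_def add_divide_distrib[symmetric] field_simps)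
  have "s > 0" "t > 0"
    using pq by (auto simp: s_def t_def zero_less_divide_iff)
  have "convex hull {a, b, c} \<subseteq> K"
    using assms(1-3) convex_K by (simp add: hull_minimal)
  moreover have "m \<in> convex hull {a, b, c}"
    unfolding convex_hull_3 using m
    by (force intro!: exI[of _ "1/3::real"])
  ultimately have "m \<in> K"
    by blast
  have ac: "(a + c) / 2 = s * c + (1 - s) * m" and bc: "(b + c) / 2 = t * c + (1 - t) * m"
  proof -
    have "a = m + p" "b = m + q"
      by (simp_all add: p_def q_def)
    moreover have "s * (p + q) = q / 2" "t * (p + q) = p / 2"
      using sum by (simp_all add: s_def t_def divide_simps)
    ultimately show "(a + c) / 2 = s * c + (1 - s) * m" "(b + c) / 2 = t * c + (1 - t) * m"
      by (simp_all add: c left_diff_distrib right_diff_distrib diff_divide_distrib add_divide_distrib)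
  qed
  have "\<sigma> * g ((a + c) / 2) \<le> \<sigma> * (h s * g c + h (1 - s) * g m)"
    unfolding ac using \<open>c \<in> K\<close> \<open>m \<in> K\<close> \<open>s > 0\<close> \<open>t > 0\<close> st by (intro h_convex) auto
  moreover have "\<sigma> * g ((b + c) / 2) \<le> \<sigma> * (h t * g c + h (1 - t) * g m)"
    unfolding bc using \<open>c \<in> K\<close> \<open>m \<in> K\<close> \<open>s > 0\<close> \<open>t > 0\<close> st by (intro h_convex) auto
  moreover have "(\<sigma> * (h s + h t)) * g c \<le> (\<sigma> * h (1/2)) * g c"
    using h_additive[of s t] \<open>s > 0\<close> \<open>t > 0\<close> st pos[OF \<open>c \<in> K\<close>]
    by (intro mult_right_mono) auto
  moreover have "(\<sigma> * (h (1 - s) + h (1 - t))) * g m \<le> (\<sigma> * h (3/2)) * g m"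
  proof -
    have weights: "(1 - s) + (1 - t) = 3/2"
      using st by simp
    have "\<sigma> * (h (1 - s) + h (1 - t)) \<le> \<sigma> * h (3/2)"
      using h_additive[of "1 - s" "1 - t", unfolded weights] \<open>s > 0\<close> \<open>t > 0\<close> st by simp
    then show ?thesis
      using pos[OF \<open>m \<in> K\<close>] by (intro mult_right_mono) auto
  qed
  moreover note midpoint[OF \<open>a \<in> K\<close> \<open>b \<in> K\<close>]
  ultimately show ?thesis
    by (simp add: algebra_simps)
qed

theorem popoviciu:
  assumes "a \<in> K" "b \<in> K" "c \<in> K"
  shows "\<sigma> * (g ((a + b) / 2) + g ((a + c) / 2) + g ((b + c) / 2))
    \<le> \<sigma> * (h (1/2) * (g a + g b + g c) + h (3/2) * g ((a + b + c) / 3))"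
proof -
  define m where "m = (a + b + c) / 3"
  have perm: "(a + c + b) / 3 = m" "(b + c + a) / 3 = m"
    by (simp_all add: m_def algebra_simps)
  consider "a = m" | "b = m" | "c = m"
    | "(a - m) * (b - m) > 0" | "(a - m) * (c - m) > 0" | "(b - m) * (c - m) > 0"
    by (auto simp: zero_less_mult_iff) linarith
  then show ?thesis
  proof cases
    case 1
    then show ?thesis
      using popoviciu_at_mean[of b c a] assms perm m_def by (simp add: add_ac)
  next
    case 2
    then show ?thesis
      using popoviciu_at_mean[of a c b] assms perm m_def by (simp add: add_ac)
  next
    case 3
    then show ?thesis
      using popoviciu_at_mean[of a b c] assms m_def by (simp add: add_ac)
  next
    case 4
    then show ?thesis
      using popoviciu_same_side[of a b c m] assms m_def by (simp add: add_ac)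
  next
    case 5
    then show ?thesis
      using popoviciu_same_side[of a c b m] assms perm m_def by (simp add: add_ac)
  next
    case 6
    then show ?thesis
      using popoviciu_same_side[of b c a m] assms perm m_def by (simp add: add_ac)
  qed
qed

end

section \<open>Passing to reciprocals\<close>

lemma convex_reciprocals:
  fixes I :: "real set"
  assumes "is_interval I"
  shows "convex {u. 0 < u \<and> 1 / u \<in> I}"
proof -
  have "1 / w \<in> I"
    if "0 < u" "1 / u \<in> I" "1 / v \<in> I" "u \<le> w" "w \<le> v" for u v w
  proof -
    have "1 / v \<le> 1 / w" "1 / w \<le> 1 / u"
      using that by (auto intro!: divide_left_mono)
    with that assms show ?thesis
      unfolding is_interval_1 by blast
  qed
  then have "is_interval {u. 0 < u \<and> 1 / u \<in> I}"
    unfolding is_interval_1 by auto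
  then show ?thesis
    by (rule is_interval_convex)
qed

lemma weighted_harmonic_mean_reciprocal:
  fixes u v t :: real
  assumes "u > 0" "v > 0"
  shows "1 / v * (1 / u) / (t * (1 / v) + (1 - t) * (1 / u)) = 1 / (t * u + (1 - t) * v)"
proof -
  have "t * (1 / v) + (1 - t) * (1 / u) = (t * u + (1 - t) * v) / (u * v)"
    using assms by (simp add: field_simps)
  then show ?thesis
    using assms by simp
qed

text \<open>The two convexity conditions on \<open>f\<close> can be inverted because their denominators are
  positive, which comes from \<open>h t\<close> and \<open>h (1 - t)\<close> being nonnegative and not both zero.\<close>

lemma reciprocal_signed_h_convex:
  fixes I J :: "real set" and h f :: "real \<Rightarrow> real"
  assumes I: "is_interval I" and J: "is_interval J" and "{0<..<1} \<subseteq> J" "3/2 \<in> J"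
    and h_nonneg: "\<And>t. t \<in> J \<Longrightarrow> h t \<ge> 0"
    and h_not_both_zero: "\<And>t. t \<in> J \<Longrightarrow> 1 - t \<in> J \<Longrightarrow> \<not> (h t = 0 \<and> h (1 - t) = 0)"
    and f_pos: "\<And>x. x \<in> I \<Longrightarrow> f x > 0"
    and \<sigma>: "\<sigma> = 1 \<and> superadditive_on J h \<and> HtHh_concave I J h f
      \<or> \<sigma> = -1 \<and> subadditive_on J h \<and> HtHh_convex I J h f"
  shows "signed_h_convex {u. 0 < u \<and> 1 / u \<in> I} h (\<lambda>u. 1 / f (1 / u)) \<sigma>"
    (is "signed_h_convex ?K h ?g \<sigma>")
proof
  show "convex ?K"
    by (rule convex_reciprocals[OF I])
  show "?g u > 0" if "u \<in> ?K" for u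
    using that f_pos by simp
  show "\<sigma> * ?g (t * u + (1 - t) * v) \<le> \<sigma> * (h t * ?g u + h (1 - t) * ?g v)"
    if "u \<in> ?K" "v \<in> ?K" "0 < t" "t < 1" for u v t
  proof -
    define w where "w = t * u + (1 - t) * v"
    define D where "D = h t * f (1 / v) + h (1 - t) * f (1 / u)"
    have "w \<in> ?K"
      using convexD[OF convex_reciprocals[OF I] that(1,2), of t "1 - t"] that(3,4)
      by (simp add: w_def)
    then have fw: "f (1 / w) > 0"
      using f_pos by simp
    have fu: "f (1 / u) > 0" and fv: "f (1 / v) > 0"
      using that f_pos by auto
    have tJ: "t \<in> J" "1 - t \<in> J"
      using \<open>{0<..<1} \<subseteq> J\<close> that by auto
    have "D > 0"
    proof -
      have "h t > 0 \<or> h (1 - t) > 0"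
        using h_nonneg[OF tJ(1)] h_nonneg[OF tJ(2)] h_not_both_zero[OF tJ] by auto
      then show ?thesis
        unfolding D_def using h_nonneg[OF tJ(1)] h_nonneg[OF tJ(2)] fu fv
        by (auto intro: add_pos_nonneg add_nonneg_pos)
    qed
    have D: "h t * ?g u + h (1 - t) * ?g v = D / (f (1 / v) * f (1 / u))"
      using fu fv by (simp add: D_def field_simps)
    have mean: "1 / v * (1 / u) / (t * (1 / v) + (1 - t) * (1 / u)) = 1 / w"
      unfolding w_def using that by (intro weighted_harmonic_mean_reciprocal) auto
    have t01: "t \<in> {0..1}"
      using that by auto
    have vu: "1 / v \<in> I" "1 / u \<in> I"
      using that by auto
    have "\<sigma> * (1 / f (1 / w)) \<le> \<sigma> * (D / (f (1 / v) * f (1 / u)))"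
      using \<sigma>
    proof (elim disjE conjE)
      assume "\<sigma> = 1" "HtHh_concave I J h f"
      then have "f (1 / w) \<ge> f (1 / v) * f (1 / u) / D"
        unfolding HtHh_concave_def using vu t01 tJ mean D_def by metis
      then show ?thesis
        using \<open>\<sigma> = 1\<close> fu fv fw \<open>D > 0\<close> by (simp add: field_simps)
    next
      assume "\<sigma> = -1" "HtHh_convex I J h f"
      then have "f (1 / w) \<le> f (1 / v) * f (1 / u) / D"
        unfolding HtHh_convex_def using vu t01 tJ mean D_def by metis
      then show ?thesis
        using \<open>\<sigma> = -1\<close> fu fv fw \<open>D > 0\<close> by (simp add: field_simps)
    qed
    then show ?thesis
      unfolding D w_def .
  qed
  show "\<sigma> * (h s + h t) \<le> \<sigma> * h (s + t)" if "0 < s" "0 < t" "s + t \<le> 3/2" for s t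
  proof -
    have "r \<in> J" if "0 < r" "r \<le> 3/2" for r
    proof -
      have "min r (1/2) \<in> J"
        using \<open>{0<..<1} \<subseteq> J\<close> that by auto
      then show ?thesis
        using mem_is_interval_1_I[OF J _ \<open>3/2 \<in> J\<close>, of "min r (1/2)" r] that by auto
    qed
    then have J_st: "s \<in> J" "t \<in> J" "s + t \<in> J"
      using that by auto
    from \<sigma> show ?thesis
    proof (elim disjE conjE)
      assume "\<sigma> = 1" "superadditive_on J h"
      then show ?thesis
        using J_st by (simp add: superadditive_on_def)
    next
      assume "\<sigma> = -1" "subadditive_on J h"
      then have "h (s + t) \<le> h s + h t"
        using J_st by (simp add: subadditive_on_def)
      then show ?thesis
        using \<open>\<sigma> = -1\<close> by simp
    qed
  qed
qed

theorem theorem10: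
  fixes I J :: "real set" and h f :: "real \<Rightarrow> real"
  assumes "is_interval I" and "I \<subseteq> {0<..}"
    and "is_interval J" and "{0<..<1} \<subseteq> J" and "3/2 \<in> J"
    and "\<And>t. t \<in> J \<Longrightarrow> h t \<ge> 0"
    and "\<And>t. t \<in> J \<Longrightarrow> 1 - t \<in> J \<Longrightarrow> \<not> (h t = 0 \<and> h (1 - t) = 0)"
    and "\<And>x. x \<in> I \<Longrightarrow> f x > 0"
  shows "(superadditive_on J h \<and> HtHh_concave I J h f \<longrightarrow>
           (\<forall>x\<in>I. \<forall>y\<in>I. \<forall>z\<in>I.
              1 / f (2*x*z / (x + z)) + 1 / f (2*y*z / (y + z)) + 1 / f (2*x*y / (x + y))
                \<le> h (1/2) * (1 / f x + 1 / f y + 1 / f z)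
                   + h (3/2) / f (3*x*y*z / (x*y + y*z + x*z))))
       \<and> (subadditive_on J h \<and> HtHh_convex I J h f \<longrightarrow>
           (\<forall>x\<in>I. \<forall>y\<in>I. \<forall>z\<in>I.
              1 / f (2*x*z / (x + z)) + 1 / f (2*y*z / (y + z)) + 1 / f (2*x*y / (x + y))
                \<ge> h (1/2) * (1 / f x + 1 / f y + 1 / f z)
                   + h (3/2) / f (3*x*y*z / (x*y + y*z + x*z))))"
proof -
  have signed: "\<sigma> * (1 / f (2*x*z / (x + z)) + 1 / f (2*y*z / (y + z)) + 1 / f (2*x*y / (x + y)))
      \<le> \<sigma> * (h (1/2) * (1 / f x + 1 / f y + 1 / f z)
          + h (3/2) / f (3*x*y*z / (x*y + y*z + x*z)))"
    if \<sigma>: "\<sigma> = 1 \<and> superadditive_on J h \<and> HtHh_concave I J h f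
        \<or> \<sigma> = -1 \<and> subadditive_on J h \<and> HtHh_convex I J h f"
      and xyz: "x \<in> I" "y \<in> I" "z \<in> I" for \<sigma> x y z :: real
  proof -
    interpret signed_h_convex "{u. 0 < u \<and> 1 / u \<in> I}" h "\<lambda>u. 1 / f (1 / u)" \<sigma>
      using assms(1,3-8) \<sigma> by (rule reciprocal_signed_h_convex)
    have pos: "x > 0" "y > 0" "z > 0"
      using xyz \<open>I \<subseteq> {0<..}\<close> by auto
    have harmonic2: "1 / ((1 / v + 1 / w) / 2) = 2 * v * w / (v + w)" if "v > 0" "w > 0" for v w :: real
      using that by (simp add: field_simps)
    have harmonic3: "1 / ((1 / x + 1 / y + 1 / z) / 3) = 3*x*y*z / (x*y + y*z + x*z)"
    proof -
      have "1 / x + 1 / y + 1 / z = (x*y + y*z + x*z) / (x*y*z)"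
        using pos by (simp add: field_simps)
      then show ?thesis
        by simp
    qed
    show ?thesis
      using popoviciu[of "1 / x" "1 / y" "1 / z"] xyz pos
      unfolding harmonic3 harmonic2[OF pos(1,2)] harmonic2[OF pos(1,3)] harmonic2[OF pos(2,3)]
      by (simp add: add_ac)
  qed
  show ?thesis
  proof ((rule conjI; intro impI ballI), goal_cases)
    case (1 x y z)
    then show ?case
      using signed[of 1 x y z] by simp
  next
    case (2 x y z)
    show ?case
      using signed[OF disjI2[OF conjI[OF refl 2(1)]] 2(2-4)]
      unfolding mult_minus1 neg_le_iff_le .
  qed
qed

end
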